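(* Let $(\mathfrak{g}_-,h_-,I_-)$ be a flat pseudo-Kähler Lie algebra of dimension $2n$ with Levi-Civita connection $\nabla^-$. Let $\mathfrak{g}_+=\mathbb{R}^{2n}$ (abelian), let $Q\colon\mathfrak{g}_+\to\mathfrak{g}_-$ be an isomorphism of vector spaces, set $h_+=Q^*h_-$ and $I_+=-Q^{-1}I_-Q$, and define the representation $\varphi\colon\mathfrak{g}_-\to\mathrm{Der}(\mathfrak{g}_+)$ by $\varphi(X_-)=Q^{-1}\nabla^-_{X_-}Q$. Set $$h=\begin{pmatrix}h_+&0\\0&h_-\end{pmatrix},\quad J=\begin{pmatrix}0&-Q^{-1}\\Q&0\end{pmatrix},\quad I=\begin{pmatrix}I_+&0\\0&I_-\end{pmatrix}$$ with respect to the splitting $\mathfrak{g}_+\oplus\mathfrak{g}_-$. Then $(h,J,I)$ is a pseudo-hyperkähler structure on $\mathfrak{g}_+\rtimes_\varphi\mathfrak{g}_-$.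
   Context: All Lie algebras are real and finite-dimensional. A pseudo-Riemannian metric on a Lie algebra is a non-degenerate symmetric bilinear form of arbitrary signature; it is flat if the curvature of its Levi-Civita connection (given by the Koszul formula on the Lie algebra) vanishes. A pseudo-Kähler structure on a Lie algebra is a pair $(h,J)$ of a pseudo-Riemannian metric $h$ and an endomorphism $J$ with $J^2=-\mathrm{Id}$, $h(J\cdot,J\cdot)=h(\cdot,\cdot)$ and $\nabla^hJ=0$, where $\nabla^h$ is the Levi-Civita connection of $h$; it is flat if $h$ is flat. A pseudo-hyperkähler structure $(h,J,I)$ on a Lie algebra is a pair of anti-commuting complex structures $J$ and $I$ such that both $(h,J)$ and $(h,I)$ are pseudo-Kähler for a pseudo-Riemannian metric $h$. For a representation $\varphi\colon\mathfrak{g}_-\to\mathrm{Der}(\mathfrak{g}_+)$, $\mathfrak{g}_+\rtimes_\varphi\mathfrak{g}_-$ is the Lie algebra on $\mathfrak{g}_+\oplus\mathfrak{g}_-$ with bracket $[X_++X_-,Y_++Y_-]=[X_+,Y_+]_++\varphi(X_-)Y_+-\varphi(Y_-)X_++[X_-,Y_-]_-$. *)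

theory Defs
  imports "HOL-Analysis.Analysis"
begin

text \<open>
  A Lie algebra is given by a bracket on a whole finite-dimensional real vector space type.
  The space is only assumed to be of class \<^class>\<open>real_vector\<close>, so that it carries no
  preferred inner product; finite-dimensionality is part of the predicate.
\<close>

definition lie_algebra :: "('a::real_vector \<Rightarrow> 'a \<Rightarrow> 'a) \<Rightarrow> bool" where
  "lie_algebra br \<longleftrightarrow>
     (\<exists>B::'a set. finite B \<and> span B = UNIV) \<and>
     bilinear br \<and>
     (\<forall>X. br X X = 0) \<and>
     (\<forall>X Y Z. br X (br Y Z) + br Y (br Z X) + br Z (br X Y) = 0)"

definition pseudo_riemannian :: "('a::real_vector \<Rightarrow> 'a \<Rightarrow> real) \<Rightarrow> bool" where
  "pseudo_riemannian h \<longleftrightarrow>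
     bilinear h \<and>
     (\<forall>X Y. h X Y = h Y X) \<and>
     (\<forall>X. (\<forall>Y. h X Y = 0) \<longrightarrow> X = 0)"

text \<open>
  The Koszul formula for left-invariant fields. The description is meaningful whenever \<open>h\<close> is
  a pseudo-Riemannian metric on a Lie algebra: non-degeneracy gives uniqueness and, together
  with finite dimension, existence.
\<close>

definition levi_civita ::
    "('a::real_vector \<Rightarrow> 'a \<Rightarrow> 'a) \<Rightarrow> ('a \<Rightarrow> 'a \<Rightarrow> real) \<Rightarrow> 'a \<Rightarrow> 'a \<Rightarrow> 'a" where
  "levi_civita br h X Y =
     (THE W. \<forall>Z. 2 * h W Z = h (br X Y) Z - h (br Y Z) X + h (br Z X) Y)"

definition curvature ::
    "('a::real_vector \<Rightarrow> 'a \<Rightarrow> 'a) \<Rightarrow> ('a \<Rightarrow> 'a \<Rightarrow> real) \<Rightarrow> 'a \<Rightarrow> 'a \<Rightarrow> 'a \<Rightarrow> 'a" where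
  "curvature br h X Y Z =
     levi_civita br h X (levi_civita br h Y Z) - levi_civita br h Y (levi_civita br h X Z)
       - levi_civita br h (br X Y) Z"

definition flat_metric ::
    "('a::real_vector \<Rightarrow> 'a \<Rightarrow> 'a) \<Rightarrow> ('a \<Rightarrow> 'a \<Rightarrow> real) \<Rightarrow> bool" where
  "flat_metric br h \<longleftrightarrow> (\<forall>X Y Z. curvature br h X Y Z = 0)"

definition pseudo_kahler ::
    "('a::real_vector \<Rightarrow> 'a \<Rightarrow> 'a) \<Rightarrow> ('a \<Rightarrow> 'a \<Rightarrow> real) \<Rightarrow> ('a \<Rightarrow> 'a) \<Rightarrow> bool" where
  "pseudo_kahler br h J \<longleftrightarrow>
     lie_algebra br \<and> pseudo_riemannian h \<and>
     linear J \<and>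
     (\<forall>X. J (J X) = - X) \<and>
     (\<forall>X Y. h (J X) (J Y) = h X Y) \<and>
     (\<forall>X Y. levi_civita br h X (J Y) = J (levi_civita br h X Y))"

text \<open>A complex structure is an almost complex structure with vanishing Nijenhuis tensor.\<close>

definition complex_structure ::
    "('a::real_vector \<Rightarrow> 'a \<Rightarrow> 'a) \<Rightarrow> ('a \<Rightarrow> 'a) \<Rightarrow> bool" where
  "complex_structure br J \<longleftrightarrow>
     linear J \<and>
     (\<forall>X. J (J X) = - X) \<and>
     (\<forall>X Y. br (J X) (J Y) - J (br (J X) Y) - J (br X (J Y)) - br X Y = 0)"

definition pseudo_hyperkahler ::
    "('a::real_vector \<Rightarrow> 'a \<Rightarrow> 'a) \<Rightarrow> ('a \<Rightarrow> 'a \<Rightarrow> real) \<Rightarrow> ('a \<Rightarrow> 'a) \<Rightarrow> ('a \<Rightarrow> 'a) \<Rightarrow> bool" where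
  "pseudo_hyperkahler br h J I \<longleftrightarrow>
     complex_structure br J \<and> complex_structure br I \<and>
     (\<forall>X. J (I X) = - I (J X)) \<and>
     pseudo_kahler br h J \<and> pseudo_kahler br h I"

definition abelian_bracket :: "'a::real_vector \<Rightarrow> 'a \<Rightarrow> 'a" where
  "abelian_bracket X Y = 0"

definition derivation :: "('p::real_vector \<Rightarrow> 'p \<Rightarrow> 'p) \<Rightarrow> ('p \<Rightarrow> 'p) \<Rightarrow> bool" where
  "derivation br D \<longleftrightarrow> linear D \<and> (\<forall>X Y. D (br X Y) = br (D X) Y + br X (D Y))"

definition derivation_representation ::
    "('a::real_vector \<Rightarrow> 'a \<Rightarrow> 'a) \<Rightarrow> ('p::real_vector \<Rightarrow> 'p \<Rightarrow> 'p) \<Rightarrow> ('a \<Rightarrow> 'p \<Rightarrow> 'p) \<Rightarrow> bool" where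
  "derivation_representation br_minus br_plus \<phi> \<longleftrightarrow>
     (\<forall>X. derivation br_plus (\<phi> X)) \<and>
     (\<forall>Y. linear (\<lambda>X. \<phi> X Y)) \<and>
     (\<forall>X X' Y. \<phi> (br_minus X X') Y = \<phi> X (\<phi> X' Y) - \<phi> X' (\<phi> X Y))"

text \<open>Pairs are written in the order \<open>(X\<^sub>+, X\<^sub>-)\<close>.\<close>

definition semidirect_bracket ::
    "('p::real_vector \<Rightarrow> 'p \<Rightarrow> 'p) \<Rightarrow> ('a::real_vector \<Rightarrow> 'a \<Rightarrow> 'a) \<Rightarrow> ('a \<Rightarrow> 'p \<Rightarrow> 'p)
      \<Rightarrow> 'p \<times> 'a \<Rightarrow> 'p \<times> 'a \<Rightarrow> 'p \<times> 'a" where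
  "semidirect_bracket br_plus br_minus \<phi> = (\<lambda>(Xp, Xm) (Yp, Ym).
     (br_plus Xp Yp + \<phi> Xm Yp - \<phi> Ym Xp, br_minus Xm Ym))"

text \<open>Block matrices with respect to the splitting, listed row by row.\<close>

definition block_endo ::
    "('p::real_vector \<Rightarrow> 'p) \<Rightarrow> ('a::real_vector \<Rightarrow> 'p) \<Rightarrow> ('p \<Rightarrow> 'a) \<Rightarrow> ('a \<Rightarrow> 'a)
      \<Rightarrow> 'p \<times> 'a \<Rightarrow> 'p \<times> 'a" where
  "block_endo A B C D = (\<lambda>(Xp, Xm). (A Xp + B Xm, C Xp + D Xm))"

definition block_form ::
    "('p::real_vector \<Rightarrow> 'p \<Rightarrow> real) \<Rightarrow> ('p \<Rightarrow> 'a::real_vector \<Rightarrow> real)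
      \<Rightarrow> ('a \<Rightarrow> 'p \<Rightarrow> real) \<Rightarrow> ('a \<Rightarrow> 'a \<Rightarrow> real)
      \<Rightarrow> 'p \<times> 'a \<Rightarrow> 'p \<times> 'a \<Rightarrow> real" where
  "block_form A B C D = (\<lambda>(Xp, Xm) (Yp, Ym). A Xp Yp + B Xp Ym + C Xm Yp + D Xm Ym)"

end

theory Submission
  imports Defs
begin

text \<open>
  Everything follows from one guess. Write elements of the semidirect product as pairs
  \<open>(a, x)\<close>, and let \<open>\<nabla>\<close> be the Levi-Civita connection of \<open>h_minus\<close>. The claim is that the
  Levi-Civita connection of \<open>h\<close> is
  \<open>D (a, x) (b, y) = (\<phi> x b, \<nabla> x y)\<close>.
  It is torsion free, because \<open>\<real>\<^sup>2\<^sup>n\<close> is abelian, so that the \<open>+\<close> part of the bracket is exactly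
  \<open>\<phi> x b - \<phi> y a\<close>; and it preserves \<open>h\<close>, because \<open>Q\<close> carries \<open>h_plus\<close> to \<open>h_minus\<close> and
  \<open>\<phi> x\<close> to \<open>\<nabla> x\<close>, so that \<open>\<phi> x\<close> is \<open>h_plus\<close>-skew. A connection with these two properties
  satisfies the Koszul formula and is therefore the Levi-Civita connection
  (\<open>levi_civita_unique\<close>, \<open>levi_civita_semidirect_abelian\<close>).

  In other words, after identifying \<open>\<real>\<^sup>2\<^sup>n\<close> with the given Lie algebra by \<open>Q\<close>, \<open>D\<close> acts as two
  copies of \<open>\<nabla> x\<close>. It commutes with \<open>J\<close>, which only exchanges the two copies up to a sign, and
  with \<open>I\<close>, which acts as \<open>-I_minus\<close> on one copy and as \<open>I_minus\<close> on the other. The opposite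
  signs are what make \<open>I\<close> and \<open>J\<close> anti-commute. Integrability is then automatic: for a parallel
  almost complex structure the Nijenhuis tensor is a combination of torsion terms
  (\<open>pseudo_kahler_imp_complex_structure\<close>).

  Flatness enters in one place only. It says that \<open>\<nabla>\<close>, and hence \<open>\<phi>\<close>, is a representation, and
  this is the part of the Jacobi identity of the semidirect product that involves \<open>\<phi>\<close>
  (\<open>lie_algebra_semidirect\<close>).

  The connection is a definite description, so its properties must be preceded by a proof that
  the Koszul formula has a solution. This is the representability of linear forms by a
  non-degenerate form in finite dimension (\<open>pseudo_riemannian_represents\<close>).
\<close>

section \<open>Non-degenerate forms\<close>

lemma nondegenerate_eqI:
  assumes h: "pseudo_riemannian h" and eq: "\<And>Z. h X Z = h Y Z"
  shows "X = Y"
proof -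
  from h have bil: "bilinear h" and nondeg: "\<And>X. (\<And>Y. h X Y = 0) \<Longrightarrow> X = 0"
    by (auto simp: pseudo_riemannian_def)
  have "X - Y = 0"
    by (rule nondeg) (simp add: bilinear_lsub[OF bil] eq)
  then show ?thesis by simp
qed

text \<open>
  In a basis \<open>B\<close>, the map sending \<open>W\<close> to the vector with coordinates \<open>h W b\<close> is linear, and
  it is injective by non-degeneracy. In finite dimension it is therefore onto, and so it
  attains the vector whose coordinates are the values of the given form on \<open>B\<close>.
\<close>
lemma pseudo_riemannian_represents:
  fixes h :: "'a::real_vector \<Rightarrow> 'a \<Rightarrow> real"
  assumes h: "pseudo_riemannian h"
    and fin: "\<exists>S::'a set. finite S \<and> span S = UNIV"
    and f: "linear f"
  shows "\<exists>W. \<forall>Z. h W Z = f Z"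
proof -
  from h have bil: "bilinear h"
    by (simp add: pseudo_riemannian_def)
  have lin1: "linear (\<lambda>x. h x y)" and lin2: "linear (h x)" for x y
    using bil by (auto simp: bilinear_def)
  obtain S :: "'a set" where S: "finite S" "span S = UNIV" using fin by blast
  obtain B where BS: "B \<subseteq> S" and ind: "independent B" and SB: "S \<subseteq> span B"
    using maximal_independent_subset by blast
  have finB: "finite B" using BS S(1) finite_subset by blast
  have spanB: "span B = UNIV"
    using SB S(2) span_minimal subspace_span by (metis top.extremum_uniqueI)
  interpret fd: finite_dimensional_vector_space "scaleR :: real \<Rightarrow> 'a \<Rightarrow> 'a" B
    by unfold_locales (use finB ind spanB in
      \<open>auto simp: dependent_raw_def span_raw_def\<close>)
  have eq_on_B: "g Z = k Z" if "linear g" "linear k" "\<And>b. b \<in> B \<Longrightarrow> g b = k b"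
    for g k :: "'a \<Rightarrow> real" and Z
    using linear_eq_on[OF that(1,2), of Z B] that(3) spanB by auto
  have coords: "c b = d b"
    if "(\<Sum>b\<in>B. c b *\<^sub>R b) = (\<Sum>b\<in>B. d b *\<^sub>R b)" and "b \<in> B" for c d b
  proof -
    have "(\<Sum>b\<in>B. (c b - d b) *\<^sub>R b) = 0"
      using that(1) by (simp add: scaleR_diff_left sum_subtractf)
    then show ?thesis
      using independentD[OF ind finB subset_refl _ that(2), of "\<lambda>b. c b - d b"] by simp
  qed
  define T where "T x = (\<Sum>b\<in>B. h x b *\<^sub>R b)" for x
  have linT: "linear T"
    unfolding T_def
    by (intro linearI) (simp_all add: linear_add[OF lin1] linear_scale[OF lin1]
        scaleR_add_left sum.distrib scaleR_sum_right)
  have "inj T"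
  proof (rule injI)
    fix x y assume "T x = T y"
    then have "h x b = h y b" if "b \<in> B" for b
      using coords that unfolding T_def by blast
    then have "h x Z = h y Z" for Z
      by (rule eq_on_B[OF lin2 lin2])
    then show "x = y" by (rule nondegenerate_eqI[OF h])
  qed
  then have "surj T"
    using fd.linear_inj_imp_surj linT by (simp add: linear_def module_hom_eq_linear)
  then obtain W where "T W = (\<Sum>b\<in>B. f b *\<^sub>R b)" by (metis surjD)
  then have "h W b = f b" if "b \<in> B" for b
    using coords that unfolding T_def by blast
  then show ?thesis
    using eq_on_B[OF lin2 f] by blast
qed

section \<open>The Levi-Civita connection\<close>

text \<open>
  The right-hand side is linear in \<open>Z\<close>, so it is represented by a vector, which
  non-degeneracy makes unique. All properties of the connection are read off from this formula.
\<close>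
lemma koszul_formula:
  assumes lie: "lie_algebra br" and h: "pseudo_riemannian h"
  shows "2 * h (levi_civita br h X Y) Z = h (br X Y) Z - h (br Y Z) X + h (br Z X) Y"
proof -
  from h have bil: "bilinear h" by (simp add: pseudo_riemannian_def)
  from lie have bbr: "bilinear br" by (simp add: lie_algebra_def)
  have "linear (\<lambda>Z. (h (br X Y) Z - h (br Y Z) X + h (br Z X) Y) / 2)"
    by (rule linearI) (simp_all add: bilinear_ladd[OF bil] bilinear_radd[OF bil]
        bilinear_lmul[OF bil] bilinear_rmul[OF bil] bilinear_ladd[OF bbr] bilinear_radd[OF bbr]
        bilinear_lmul[OF bbr] bilinear_rmul[OF bbr] field_simps)
  then obtain W where "\<forall>Z. h W Z = (h (br X Y) Z - h (br Y Z) X + h (br Z X) Y) / 2"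
    using pseudo_riemannian_represents[OF h] lie unfolding lie_algebra_def by blast
  then have W: "\<forall>Z. 2 * h W Z = h (br X Y) Z - h (br Y Z) X + h (br Z X) Y"
    by (simp add: mult.commute)
  have "\<exists>!W. \<forall>Z. 2 * h W Z = h (br X Y) Z - h (br Y Z) X + h (br Z X) Y"
  proof (rule ex1I[where a = W])
    fix V assume "\<forall>Z. 2 * h V Z = h (br X Y) Z - h (br Y Z) X + h (br Z X) Y"
    with W have "h V Z = h W Z" for Z
      by (metis mult_cancel_left zero_neq_numeral)
    then show "V = W" by (rule nondegenerate_eqI[OF h])
  qed (rule W)
  from theI'[OF this] show ?thesis
    unfolding levi_civita_def by blast
qed

lemma lie_bracket_antisym:
  assumes "lie_algebra br"
  shows "br Y X = - br X Y"
proof -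
  from assms have b: "bilinear br" and z: "\<And>X. br X X = 0" by (auto simp: lie_algebra_def)
  have "br (X + Y) (X + Y) = br X Y + br Y X"
    unfolding bilinear_ladd[OF b] bilinear_radd[OF b] by (simp add: z)
  then show ?thesis by (simp add: z add_eq_0_iff)
qed

lemma bilinear_levi_civita:
  assumes lie: "lie_algebra br" and h: "pseudo_riemannian h"
  shows "bilinear (levi_civita br h)"
proof -
  from h have bil: "bilinear h" by (simp add: pseudo_riemannian_def)
  from lie have bbr: "bilinear br" by (simp add: lie_algebra_def)
  have *: "U = V" if "\<And>Z. 2 * h U Z = 2 * h V Z" for U V
    using nondegenerate_eqI[OF h, of U V] that by simp
  show ?thesis
    unfolding bilinear_def
    by (intro conjI allI linearI; rule *)
      (simp_all add: bilinear_ladd[OF bil] bilinear_lmul[OF bil] bilinear_radd[OF bil]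
        bilinear_rmul[OF bil] distrib_left mult.left_commute[of 2] koszul_formula[OF lie h]
        bilinear_ladd[OF bbr] bilinear_radd[OF bbr] bilinear_lmul[OF bbr] bilinear_rmul[OF bbr]
        algebra_simps)
qed

lemma levi_civita_torsion_free:
  assumes lie: "lie_algebra br" and h: "pseudo_riemannian h"
  shows "levi_civita br h X Y - levi_civita br h Y X = br X Y"
proof (rule nondegenerate_eqI[OF h])
  fix Z
  from h have bil: "bilinear h" by (simp add: pseudo_riemannian_def)
  have "br Y X = - br X Y" "br Z Y = - br Y Z" "br X Z = - br Z X"
    using lie_bracket_antisym[OF lie] by blast+
  then show "h (levi_civita br h X Y - levi_civita br h Y X) Z = h (br X Y) Z"
    using koszul_formula[OF lie h, of X Y Z] koszul_formula[OF lie h, of Y X Z]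
    by (simp add: bilinear_lsub[OF bil] bilinear_lneg[OF bil])
qed

lemma levi_civita_metric:
  assumes lie: "lie_algebra br" and h: "pseudo_riemannian h"
  shows "h (levi_civita br h X Y) Z + h Y (levi_civita br h X Z) = 0"
proof -
  from h have bil: "bilinear h" and sym: "h Y (levi_civita br h X Z) = h (levi_civita br h X Z) Y"
    by (auto simp: pseudo_riemannian_def)
  have "br Y X = - br X Y" "br Z Y = - br Y Z" "br X Z = - br Z X"
    using lie_bracket_antisym[OF lie] by blast+
  then show ?thesis
    unfolding sym
    using koszul_formula[OF lie h, of X Y Z] koszul_formula[OF lie h, of X Z Y]
    by (simp add: bilinear_lneg[OF bil])
qed

text \<open>
  Replacing the brackets in the Koszul formula by differences of values of \<open>D\<close> leaves six
  terms; metric compatibility cancels four of them against each other and makes the other two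
  equal. This permits computing a Levi-Civita connection by guessing it.
\<close>
lemma levi_civita_unique:
  assumes h: "pseudo_riemannian h"
    and tor: "\<And>X Y. D X Y - D Y X = br X Y"
    and met: "\<And>X Y Z. h (D X Y) Z + h Y (D X Z) = 0"
  shows "levi_civita br h = D"
proof (intro ext)
  fix X Y
  from h have bil: "bilinear h" and sym: "\<And>X Y. h X Y = h Y X"
    by (auto simp: pseudo_riemannian_def)
  have koszul: "2 * h (D X Y) Z = h (br X Y) Z - h (br Y Z) X + h (br Z X) Y" for Z
    using met[of X Y Z] met[of Y X Z] met[of Z X Y]
      sym[of Y "D X Z"] sym[of X "D Y Z"] sym[of X "D Z Y"]
    by (simp add: tor[symmetric] bilinear_lsub[OF bil])
  show "levi_civita br h X Y = D X Y"
    unfolding levi_civita_def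
  proof (rule the_equality)
    fix W assume W: "\<forall>Z. 2 * h W Z = h (br X Y) Z - h (br Y Z) X + h (br Z X) Y"
    show "W = D X Y"
      by (rule nondegenerate_eqI[OF h])
        (metis W koszul mult_cancel_left zero_neq_numeral)
  qed (use koszul in blast)
qed

text \<open>
  Express each bracket of the Nijenhuis tensor through the torsion-free connection and move
  \<open>J\<close> out of it: since \<open>J\<close> squares to \<open>-1\<close>, the terms cancel in pairs.
\<close>
lemma pseudo_kahler_imp_complex_structure:
  assumes "pseudo_kahler br h J"
  shows "complex_structure br J"
proof -
  let ?D = "levi_civita br h"
  from assms have lie: "lie_algebra br" and h: "pseudo_riemannian h" and J: "linear J"
    and JJ: "\<And>X. J (J X) = - X" and par: "\<And>X Y. ?D X (J Y) = J (?D X Y)"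
    by (auto simp: pseudo_kahler_def)
  have "br (J X) (J Y) - J (br (J X) Y) - J (br X (J Y)) - br X Y = 0" for X Y
    by (simp add: levi_civita_torsion_free[OF lie h, symmetric] par linear_diff[OF J] JJ)
  then show ?thesis by (simp add: complex_structure_def J JJ)
qed

section \<open>Direct sums and semidirect products\<close>

lemma linear_block_endo:
  assumes "linear A" "linear B" "linear C" "linear D"
  shows "linear (block_endo A B C D)"
  by (rule linearI)
    (auto simp: block_endo_def split_beta linear_add[OF assms(1)] linear_add[OF assms(2)]
      linear_add[OF assms(3)] linear_add[OF assms(4)] linear_scale[OF assms(1)]
      linear_scale[OF assms(2)] linear_scale[OF assms(3)] linear_scale[OF assms(4)]
      scaleR_add_right)

lemma pseudo_riemannian_block_diagonal:
  assumes "pseudo_riemannian hp" "pseudo_riemannian hm"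
  shows "pseudo_riemannian (block_form hp (\<lambda>_ _. 0) (\<lambda>_ _. 0) hm)"
proof -
  from assms have bp: "bilinear hp" and bm: "bilinear hm" by (auto simp: pseudo_riemannian_def)
  have "bilinear (block_form hp (\<lambda>_ _. 0) (\<lambda>_ _. 0) hm)"
    unfolding bilinear_def block_form_def
    by (intro conjI allI linearI)
      (auto simp: split_beta bilinear_ladd[OF bp] bilinear_radd[OF bp] bilinear_lmul[OF bp]
        bilinear_rmul[OF bp] bilinear_ladd[OF bm] bilinear_radd[OF bm] bilinear_lmul[OF bm]
        bilinear_rmul[OF bm] distrib_left)
  moreover have "block_form hp (\<lambda>_ _. 0) (\<lambda>_ _. 0) hm X Y
      = block_form hp (\<lambda>_ _. 0) (\<lambda>_ _. 0) hm Y X" for X Y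
    using assms by (auto simp: block_form_def pseudo_riemannian_def split_beta)
  moreover have "X = 0" if 0: "\<And>Y. block_form hp (\<lambda>_ _. 0) (\<lambda>_ _. 0) hm X Y = 0" for X
  proof -
    have "hp (fst X) b = 0" for b
      using 0[of "(b, 0)"] by (simp add: block_form_def split_beta bilinear_rzero[OF bm])
    moreover have "hm (snd X) y = 0" for y
      using 0[of "(0, y)"] by (simp add: block_form_def split_beta bilinear_rzero[OF bp])
    ultimately show ?thesis
      using assms by (simp add: pseudo_riemannian_def prod_eq_iff)
  qed
  ultimately show ?thesis by (auto simp: pseudo_riemannian_def)
qed

lemma lie_algebra_abelian:
  "lie_algebra (abelian_bracket :: 'a::euclidean_space \<Rightarrow> 'a \<Rightarrow> 'a)"
proof -
  have "\<exists>B::'a set. finite B \<and> span B = UNIV"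
    using finite_Basis span_Basis by blast
  then show ?thesis
    by (auto simp: lie_algebra_def abelian_bracket_def bilinear_def intro!: linearI)
qed

text \<open>
  By multilinearity, the \<open>+\<close> part of the Jacobi identity splits by the number of arguments
  taken from the ideal: with three it is the Jacobi identity of \<open>brp\<close>, with two it says that
  \<open>\<phi>\<close> acts by derivations, with one that \<open>\<phi>\<close> is a representation.
\<close>
lemma lie_algebra_semidirect:
  fixes brp :: "'p::real_vector \<Rightarrow> 'p \<Rightarrow> 'p" and brm :: "'a::real_vector \<Rightarrow> 'a \<Rightarrow> 'a"
  assumes lp: "lie_algebra brp" and lm: "lie_algebra brm"
    and rep: "derivation_representation brm brp \<phi>"
  shows "lie_algebra (semidirect_bracket brp brm \<phi>)"
proof -
  from lp have bp: "bilinear brp" and pz: "\<And>X. brp X X = 0"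
    and pj: "\<And>X Y Z. brp X (brp Y Z) + brp Y (brp Z X) + brp Z (brp X Y) = 0"
    by (auto simp: lie_algebra_def)
  from lm have bm: "bilinear brm" and mz: "\<And>X. brm X X = 0"
    and mj: "\<And>X Y Z. brm X (brm Y Z) + brm Y (brm Z X) + brm Z (brm X Y) = 0"
    by (auto simp: lie_algebra_def)
  from rep have lin1: "\<And>Y. linear (\<lambda>X. \<phi> X Y)" and lin2: "\<And>X. linear (\<phi> X)"
    and der: "\<And>X Y Z. \<phi> X (brp Y Z) = brp (\<phi> X Y) Z + brp Y (\<phi> X Z)"
    and com: "\<And>X X' Y. \<phi> (brm X X') Y = \<phi> X (\<phi> X' Y) - \<phi> X' (\<phi> X Y)"
    by (auto simp: derivation_representation_def derivation_def)
  let ?br = "semidirect_bracket brp brm \<phi>"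
  obtain B :: "'p set" and C :: "'a set"
    where B: "finite B" "span B = UNIV" and C: "finite C" "span C = UNIV"
    using lp lm unfolding lie_algebra_def by blast
  have fin: "finite (B \<times> {0} \<union> {0} \<times> C)" using B C by simp
  have gen: "span (B \<times> {0} \<union> {0} \<times> C) = (UNIV :: ('p \<times> 'a) set)" (is "span ?G = _")
  proof -
    have 1: "span ((\<lambda>x. (x, 0 :: 'a)) ` B) = (\<lambda>x. (x, 0)) ` span B"
      by (rule linear_span_image) (auto intro!: linearI)
    have 2: "span (Pair (0 :: 'p) ` C) = Pair 0 ` span C"
      by (rule linear_span_image) (auto intro!: linearI)
    have "(x, 0 :: 'a) \<in> span ?G" for x
      using span_mono[of "(\<lambda>x. (x, 0 :: 'a)) ` B" ?G] 1 B by auto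
    moreover have "(0 :: 'p, y) \<in> span ?G" for y
      using span_mono[of "Pair (0 :: 'p) ` C" ?G] 2 C by auto
    ultimately have "(x, 0) + (0, y) \<in> span ?G" for x y
      by (rule span_add)
    then show ?thesis by auto
  qed
  have bil: "bilinear ?br"
    unfolding bilinear_def semidirect_bracket_def
    by (intro conjI allI linearI)
      (auto simp: split_beta bilinear_ladd[OF bp] bilinear_radd[OF bp] bilinear_lmul[OF bp]
        bilinear_rmul[OF bp] bilinear_ladd[OF bm] bilinear_radd[OF bm] bilinear_lmul[OF bm]
        bilinear_rmul[OF bm] linear_add[OF lin1] linear_add[OF lin2] linear_scale[OF lin1]
        linear_scale[OF lin2] algebra_simps)
  have anti: "brp u v = - brp v u" for u v
    using lie_bracket_antisym[OF lp] .
  have jac: "?br X (?br Y Z) + ?br Y (?br Z X) + ?br Z (?br X Y) = 0" for X Y Z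
  proof -
    obtain a x b y c z where [simp]: "X = (a, x)" "Y = (b, y)" "Z = (c, z)"
      by (metis surj_pair)
    \<comment> \<open>The six instances of \<open>anti\<close> put the \<open>\<phi>\<close> term second, which makes the derivation terms
      cancel. Antisymmetry as a rewrite rule would loop.\<close>
    show ?thesis
      using pj[of a b c] mj[of x y z]
      by (simp add: semidirect_bracket_def zero_prod_def bilinear_radd[OF bp]
          bilinear_rsub[OF bp] linear_add[OF lin2] linear_diff[OF lin2] der com
          anti[of "\<phi> x b" c] anti[of "\<phi> y c" a] anti[of "\<phi> z a" b]
          anti[of "\<phi> x c" b] anti[of "\<phi> y a" c] anti[of "\<phi> z b" a] algebra_simps)
  qed
  have "?br X X = 0" for X
    by (cases X) (simp add: semidirect_bracket_def pz mz zero_prod_def)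
  with fin gen bil jac show ?thesis
    unfolding lie_algebra_def by blast
qed

text \<open>
  The ideal contributes nothing as a direction of differentiation, because both its bracket
  and the symmetric part of each \<open>\<phi> x\<close> vanish:
  the complement acts on it by infinitesimal isometries.
\<close>
lemma levi_civita_semidirect_abelian:
  assumes lm: "lie_algebra brm" and hp: "pseudo_riemannian hp" and hm: "pseudo_riemannian hm"
    and skew: "\<And>x a b. hp (\<phi> x a) b + hp a (\<phi> x b) = 0"
  shows "levi_civita (semidirect_bracket abelian_bracket brm \<phi>)
      (block_form hp (\<lambda>_ _. 0) (\<lambda>_ _. 0) hm)
    = (\<lambda>(a, x) (b, y). (\<phi> x b, levi_civita brm hm x y))"
proof (rule levi_civita_unique[OF pseudo_riemannian_block_diagonal[OF hp hm]])
  let ?D = "\<lambda>(a, x) (b, y). (\<phi> x b, levi_civita brm hm x y)"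
  fix X Y Z
  show "?D X Y - ?D Y X = semidirect_bracket abelian_bracket brm \<phi> X Y"
    by (simp add: split_beta semidirect_bracket_def abelian_bracket_def
        levi_civita_torsion_free[OF lm hm])
  show "block_form hp (\<lambda>_ _. 0) (\<lambda>_ _. 0) hm (?D X Y) Z
      + block_form hp (\<lambda>_ _. 0) (\<lambda>_ _. 0) hm Y (?D X Z) = 0"
    using skew[of "snd X" "fst Y" "fst Z"] levi_civita_metric[OF lm hm, of "snd X" "snd Y" "snd Z"]
    by (simp add: split_beta block_form_def)
qed

section \<open>The pseudo-hyperkaehler structure\<close>

theorem proposition3p12:
  fixes br_minus :: "'a::real_vector \<Rightarrow> 'a \<Rightarrow> 'a"
    and h_minus :: "'a \<Rightarrow> 'a \<Rightarrow> real"
    and I_minus :: "'a \<Rightarrow> 'a"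
    and n :: nat
    and Q :: "real ^ 'm::finite \<Rightarrow> 'a"
    and br_plus :: "real ^ 'm \<Rightarrow> real ^ 'm \<Rightarrow> real ^ 'm"
    and h_plus :: "real ^ 'm \<Rightarrow> real ^ 'm \<Rightarrow> real"
    and I_plus :: "real ^ 'm \<Rightarrow> real ^ 'm"
    and \<phi> :: "'a \<Rightarrow> real ^ 'm \<Rightarrow> real ^ 'm"
    and h :: "(real ^ 'm) \<times> 'a \<Rightarrow> (real ^ 'm) \<times> 'a \<Rightarrow> real"
    and J I :: "(real ^ 'm) \<times> 'a \<Rightarrow> (real ^ 'm) \<times> 'a"
  assumes "pseudo_kahler br_minus h_minus I_minus"
    and "flat_metric br_minus h_minus"
    and "dim (UNIV :: 'a set) = 2 * n"
    and "CARD('m) = 2 * n"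
    and "br_plus = abelian_bracket"
    and "linear Q" and "bij Q"
    and "h_plus = (\<lambda>X Y. h_minus (Q X) (Q Y))"
    and "I_plus = (\<lambda>X. - inv Q (I_minus (Q X)))"
    and "\<phi> = (\<lambda>X Y. inv Q (levi_civita br_minus h_minus X (Q Y)))"
    and "h = block_form h_plus (\<lambda>_ _. 0) (\<lambda>_ _. 0) h_minus"
    and "J = block_endo (\<lambda>_. 0) (\<lambda>X. - inv Q X) Q (\<lambda>_. 0)"
    and "I = block_endo I_plus (\<lambda>_. 0) (\<lambda>_. 0) I_minus"
  shows "derivation_representation br_minus br_plus \<phi> \<and>
    pseudo_hyperkahler (semidirect_bracket br_plus br_minus \<phi>) h J I"
proof -
  let ?D = "levi_civita br_minus h_minus"
  let ?br = "semidirect_bracket br_plus br_minus \<phi>"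
  note kahler = assms(1) and flat = assms(2) and Q = assms(6,7)
  from kahler have lie: "lie_algebra br_minus" and met: "pseudo_riemannian h_minus"
    and Im: "linear I_minus" and Im2: "\<And>X. I_minus (I_minus X) = - X"
    and Ih: "\<And>X Y. h_minus (I_minus X) (I_minus Y) = h_minus X Y"
    and ID: "\<And>X Y. ?D X (I_minus Y) = I_minus (?D X Y)"
    by (auto simp: pseudo_kahler_def)
  have bh: "bilinear h_minus" using met by (simp add: pseudo_riemannian_def)
  have bD: "bilinear ?D" by (rule bilinear_levi_civita[OF lie met])
  have lD1: "linear (\<lambda>X. ?D X Y)" and lD2: "linear (?D X)" for X Y
    using bD by (auto simp: bilinear_def)
  have QP [simp]: "Q (inv Q x) = x" and PQ [simp]: "inv Q (Q a) = a" for x a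
    using Q(2) by (simp_all add: bij_is_inj bij_is_surj surj_f_inv_f)
  have P: "linear (inv Q)"
    by (rule linearI)
      (metis PQ QP linear_add[OF Q(1)], metis PQ QP linear_scale[OF Q(1)])
  note lin_simps = linear_add[OF Q(1)] linear_scale[OF Q(1)] linear_neg[OF Q(1)] linear_neg[OF P]
    linear_neg[OF Im] linear_neg[OF lD2]

  have plus: "lie_algebra br_plus" by (simp add: assms(5) lie_algebra_abelian)
  have lphi2: "linear (\<phi> X)" and lphi1: "linear (\<lambda>X. \<phi> X Y)" for X Y
    using linear_compose[OF Q(1) linear_compose[OF lD2 P], of X]
      linear_compose[OF lD1 P, of "Q Y"]
    by (simp_all add: assms(10) o_def)
  have rep: "derivation_representation br_minus br_plus \<phi>"
  proof -
    \<comment> \<open>Vanishing curvature is the representation property of \<open>?D\<close>; \<open>\<phi>\<close> is conjugate to \<open>?D\<close>.\<close>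
    have "\<phi> (br_minus X X') Y = \<phi> X (\<phi> X' Y) - \<phi> X' (\<phi> X Y)" for X X' Y
    proof -
      have "?D (br_minus X X') (Q Y) = ?D X (?D X' (Q Y)) - ?D X' (?D X (Q Y))"
        using flat by (simp add: flat_metric_def curvature_def)
      then show ?thesis by (simp add: assms(10) linear_diff[OF P])
    qed
    then show ?thesis
      using lphi1 lphi2 linear_0[OF lphi2]
      by (simp add: derivation_representation_def derivation_def assms(5) abelian_bracket_def)
  qed
  have lie_semi: "lie_algebra ?br"
    by (rule lie_algebra_semidirect[OF plus lie rep])

  have hp: "pseudo_riemannian h_plus"
  proof -
    have "bilinear h_plus"
      unfolding assms(8) bilinear_def
      by (intro conjI allI linearI) (simp_all add: lin_simps bilinear_ladd[OF bh]
          bilinear_radd[OF bh] bilinear_lmul[OF bh] bilinear_rmul[OF bh])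
    moreover have "X = 0" if "\<And>Y. h_plus X Y = 0" for X
    proof -
      have "h_minus (Q X) Y = 0" for Y
        using that[of "inv Q Y"] by (simp add: assms(8))
      then have "Q X = 0" using met by (auto simp: pseudo_riemannian_def)
      then show ?thesis using PQ[of X] linear_0[OF P] by simp
    qed
    ultimately show ?thesis
      using met by (auto simp: pseudo_riemannian_def assms(8))
  qed
  have h: "pseudo_riemannian h"
    unfolding assms(11) by (rule pseudo_riemannian_block_diagonal[OF hp met])
  have LC: "levi_civita ?br h = (\<lambda>(a, x) (b, y). (\<phi> x b, ?D x y))"
    unfolding assms(11) assms(5)
    by (rule levi_civita_semidirect_abelian[OF lie hp met])
      (simp add: assms(8,10) levi_civita_metric[OF lie met])

  have lJ: "linear J"
    unfolding assms(12)
    by (intro linear_block_endo Q(1) linear_compose_neg P linear_zero)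
  have lI: "linear I"
    unfolding assms(13,9)
    using linear_compose[OF Q(1) linear_compose[OF Im P]]
    by (intro linear_block_endo linear_compose_neg Im linear_zero) (simp add: o_def)
  have J: "pseudo_kahler ?br h J"
    unfolding pseudo_kahler_def LC
    using lie_semi h lJ
    by (auto simp: assms(8,10,11,12) block_endo_def block_form_def lin_simps
        bilinear_lneg[OF bh] bilinear_rneg[OF bh])
  have I: "pseudo_kahler ?br h I"
    unfolding pseudo_kahler_def LC
    using lie_semi h lI
    by (auto simp: assms(8,9,10,11,13) block_endo_def block_form_def lin_simps
        bilinear_lneg[OF bh] bilinear_rneg[OF bh] Im2 Ih ID)
  have "J (I X) = - I (J X)" for X
    by (cases X) (simp add: assms(9,12,13) block_endo_def lin_simps)
  with rep I J show ?thesis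
    by (simp add: pseudo_hyperkahler_def pseudo_kahler_imp_complex_structure)
qed

end
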